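(* There exist a uniformly smooth and uniformly convex real Banach space $E$ and a countable family $\{M_k\}_{k=1}^{\infty}$ of maximal monotone operators $M_k:E\to2^{E^{*}}$ such that the full intersection $\bigcap_{k=1}^{\infty}M_k^{-1}0$ is a singleton, while for every $N\in\mathbb N$ the solution set $\bigcap_{k=1}^{N}M_k^{-1}0$ of the finite truncation is infinite-dimensional.
   Context: For $M:E\to2^{E^{*}}$, $M^{-1}0=\{x\in E:0\in Mx\}$ is the solution set of the inclusion problem $0\in Mx$. $M$ is monotone if $\langle x-y,x^{*}-y^{*}\rangle\ge0$ whenever $x^{*}\in Mx$, $y^{*}\in My$, and maximal monotone if its graph is not properly contained in the graph of another monotone operator. A subset of $E$ is called infinite-dimensional if it is not contained in any finite-dimensional affine subspace of $E$. *)

theory Defs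
  imports
    "HOL-Analysis.Analysis"
    "HOL-Algebra.Module"
    "HOL-Algebra.AbelCoset"
    "HOL-Algebra.Algebraic_Closure_Type"
begin

text \<open>
  A theorem cannot quantify existentially over types, so spaces whose existence is asserted are
  structures with an explicit carrier: HOL-Algebra modules over the field of real numbers, extended
  by a norm. (As in HOL-Algebra, the ring multiplication and unit inherited by the record are not
  constrained for modules and play no role.)
\<close>

record 'a normed_space = "(real, 'a) module" +
  nrm :: "'a \<Rightarrow> real"  (\<open>\<parallel>_\<parallel>\<index>\<close>)

text \<open>The distance is set to 0 off the carrier because the locale \<open>Metric_space\<close> requires
  nonnegativity and symmetry on the whole type.\<close>

definition ndist :: "'a normed_space \<Rightarrow> 'a \<Rightarrow> 'a \<Rightarrow> real" where
  "ndist E x y = (if x \<in> carrier E \<and> y \<in> carrier E then \<parallel>x \<ominus>\<^bsub>E\<^esub> y\<parallel>\<^bsub>E\<^esub> else 0)"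

locale real_normed_space = Module.module "ring_of_type_algebra :: real ring" E
  for E :: "'a normed_space" (structure) +
  assumes nrm_nonneg: "x \<in> carrier E \<Longrightarrow> 0 \<le> \<parallel>x\<parallel>"
    and nrm_eq_zero_iff: "x \<in> carrier E \<Longrightarrow> \<parallel>x\<parallel> = 0 \<longleftrightarrow> x = \<zero>\<^bsub>E\<^esub>"
    and nrm_smult: "x \<in> carrier E \<Longrightarrow> \<parallel>a \<odot>\<^bsub>E\<^esub> x\<parallel> = \<bar>a\<bar> * \<parallel>x\<parallel>"
    and nrm_triangle: "x \<in> carrier E \<Longrightarrow> y \<in> carrier E \<Longrightarrow> \<parallel>x \<oplus>\<^bsub>E\<^esub> y\<parallel> \<le> \<parallel>x\<parallel> + \<parallel>y\<parallel>"
begin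

lemma Metric_space_ndist: "Metric_space (carrier E) (ndist E)"
proof
  have neg: "\<ominus>\<^bsub>E\<^esub> x = (-1) \<odot>\<^bsub>E\<^esub> x" if x: "x \<in> carrier E" for x
  proof -
    have "\<ominus>\<^bsub>E\<^esub> x = (\<ominus>\<^bsub>ring_of_type_algebra\<^esub> (1::real)) \<odot>\<^bsub>E\<^esub> x"
      using smult_l_minus[of 1 x] smult_one[OF x] x by (simp add: ring_of_type_algebra_def)
    moreover have "\<ominus>\<^bsub>ring_of_type_algebra\<^esub> (1::real) = -1"
      by (rule R.minus_equality) (auto simp: ring_of_type_algebra_def)
    ultimately show ?thesis by simp
  qed
  have sub: "\<parallel>x \<ominus>\<^bsub>E\<^esub> y\<parallel> = \<parallel>y \<ominus>\<^bsub>E\<^esub> x\<parallel>" if "x \<in> carrier E" "y \<in> carrier E" for x y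
  proof -
    have "y \<ominus>\<^bsub>E\<^esub> x = \<ominus>\<^bsub>E\<^esub> (x \<ominus>\<^bsub>E\<^esub> y)"
      using that by (simp add: M.minus_eq M.minus_add M.add.m_comm)
    then have "\<parallel>y \<ominus>\<^bsub>E\<^esub> x\<parallel> = \<parallel>(-1) \<odot>\<^bsub>E\<^esub> (x \<ominus>\<^bsub>E\<^esub> y)\<parallel>"
      using that neg by simp
    also have "\<dots> = \<parallel>x \<ominus>\<^bsub>E\<^esub> y\<parallel>"
      using that by (subst nrm_smult) auto
    finally show ?thesis by simp
  qed
  show "0 \<le> ndist E x y" for x y
    by (simp add: ndist_def nrm_nonneg)
  show "ndist E x y = ndist E y x" for x y
    by (auto simp: ndist_def sub)
  show "ndist E x y = 0 \<longleftrightarrow> x = y" if "x \<in> carrier E" "y \<in> carrier E" for x y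
  proof -
    have "x \<ominus>\<^bsub>E\<^esub> y = \<zero>\<^bsub>E\<^esub> \<longleftrightarrow> x = y"
      using that by (metis M.minus_eq M.r_neg M.minus_equality M.minus_minus M.a_inv_closed)
    then show ?thesis
      using that by (simp add: ndist_def nrm_eq_zero_iff)
  qed
  show "ndist E x z \<le> ndist E x y + ndist E y z"
    if "x \<in> carrier E" "y \<in> carrier E" "z \<in> carrier E" for x y z
  proof -
    have "x \<ominus>\<^bsub>E\<^esub> z = (x \<ominus>\<^bsub>E\<^esub> y) \<oplus>\<^bsub>E\<^esub> (y \<ominus>\<^bsub>E\<^esub> z)"
      using that by (simp add: M.minus_eq M.a_assoc M.r_neg1)
    then show ?thesis
      using that nrm_triangle[of "x \<ominus>\<^bsub>E\<^esub> y" "y \<ominus>\<^bsub>E\<^esub> z"] by (simp add: ndist_def)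
  qed
qed

end

locale real_banach_space = real_normed_space +
  assumes complete: "Metric_space.mcomplete (carrier E) (ndist E)"

definition uniformly_convex :: "'a normed_space \<Rightarrow> bool" where
  "uniformly_convex E \<longleftrightarrow>
     (\<forall>\<epsilon>. 0 < \<epsilon> \<and> \<epsilon> \<le> 2 \<longrightarrow> (\<exists>\<delta>>0. \<forall>x\<in>carrier E. \<forall>y\<in>carrier E.
        \<parallel>x\<parallel>\<^bsub>E\<^esub> = 1 \<and> \<parallel>y\<parallel>\<^bsub>E\<^esub> = 1 \<and> \<parallel>x \<ominus>\<^bsub>E\<^esub> y\<parallel>\<^bsub>E\<^esub> \<ge> \<epsilon> \<longrightarrow>
        \<parallel>(1/2) \<odot>\<^bsub>E\<^esub> (x \<oplus>\<^bsub>E\<^esub> y)\<parallel>\<^bsub>E\<^esub> \<le> 1 - \<delta>))"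

text \<open>This says that the modulus of smoothness
  \<open>\<rho>(\<tau>) = sup {(\<parallel>x + y\<parallel> + \<parallel>x - y\<parallel>) / 2 - 1 | \<parallel>x\<parallel> = 1, \<parallel>y\<parallel> = \<tau>}\<close>
  satisfies \<open>\<rho>(\<tau>) / \<tau> \<longlongrightarrow> 0\<close> as \<open>\<tau>\<close> decreases to 0.\<close>

definition uniformly_smooth :: "'a normed_space \<Rightarrow> bool" where
  "uniformly_smooth E \<longleftrightarrow>
     (\<forall>\<epsilon>>0. \<exists>\<delta>>0. \<forall>x\<in>carrier E. \<forall>y\<in>carrier E.
        \<parallel>x\<parallel>\<^bsub>E\<^esub> = 1 \<and> \<parallel>y\<parallel>\<^bsub>E\<^esub> \<le> \<delta> \<longrightarrow>
        (\<parallel>x \<oplus>\<^bsub>E\<^esub> y\<parallel>\<^bsub>E\<^esub> + \<parallel>x \<ominus>\<^bsub>E\<^esub> y\<parallel>\<^bsub>E\<^esub>) / 2 - 1 \<le> \<epsilon> * \<parallel>y\<parallel>\<^bsub>E\<^esub>)"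

text \<open>Functionals are required to be extensional, so that two elements of the dual that agree on
  the carrier are equal.\<close>

definition dual :: "'a normed_space \<Rightarrow> ('a \<Rightarrow> real) set" where
  "dual E = {f \<in> extensional (carrier E).
     (\<forall>x\<in>carrier E. \<forall>y\<in>carrier E. f (x \<oplus>\<^bsub>E\<^esub> y) = f x + f y) \<and>
     (\<forall>a. \<forall>x\<in>carrier E. f (a \<odot>\<^bsub>E\<^esub> x) = a * f x) \<and>
     (\<exists>C. \<forall>x\<in>carrier E. \<bar>f x\<bar> \<le> C * \<parallel>x\<parallel>\<^bsub>E\<^esub>)}"

definition dual_zero :: "'a normed_space \<Rightarrow> 'a \<Rightarrow> real" where
  "dual_zero E = (\<lambda>x\<in>carrier E. 0)"

definition set_valued_operator :: "'a normed_space \<Rightarrow> ('a \<Rightarrow> ('a \<Rightarrow> real) set) \<Rightarrow> bool" where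
  "set_valued_operator E M \<longleftrightarrow> M \<in> carrier E \<rightarrow> Pow (dual E)"

definition op_graph :: "'a normed_space \<Rightarrow> ('a \<Rightarrow> ('a \<Rightarrow> real) set) \<Rightarrow> ('a \<times> ('a \<Rightarrow> real)) set" where
  "op_graph E M = (SIGMA x:carrier E. M x)"

definition zeros :: "'a normed_space \<Rightarrow> ('a \<Rightarrow> ('a \<Rightarrow> real) set) \<Rightarrow> 'a set" where
  "zeros E M = {x \<in> carrier E. dual_zero E \<in> M x}"

text \<open>The pairing \<open>\<langle>x - y, f - g\<rangle>\<close> is written out as \<open>f (x - y) - g (x - y)\<close>.\<close>

definition monotone_operator :: "'a normed_space \<Rightarrow> ('a \<Rightarrow> ('a \<Rightarrow> real) set) \<Rightarrow> bool" where
  "monotone_operator E M \<longleftrightarrow> set_valued_operator E M \<and>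
     (\<forall>x\<in>carrier E. \<forall>y\<in>carrier E. \<forall>f\<in>M x. \<forall>g\<in>M y. f (x \<ominus>\<^bsub>E\<^esub> y) - g (x \<ominus>\<^bsub>E\<^esub> y) \<ge> 0)"

definition maximal_monotone_operator :: "'a normed_space \<Rightarrow> ('a \<Rightarrow> ('a \<Rightarrow> real) set) \<Rightarrow> bool" where
  "maximal_monotone_operator E M \<longleftrightarrow> monotone_operator E M \<and>
     \<not> (\<exists>M'. monotone_operator E M' \<and> op_graph E M \<subset> op_graph E M')"

definition lin_span :: "'a normed_space \<Rightarrow> 'a set \<Rightarrow> 'a set" where
  "lin_span E B = {(\<Oplus>\<^bsub>E\<^esub>v\<in>B. c v \<odot>\<^bsub>E\<^esub> v) | c. True}"

text \<open>Only used for finite \<open>B\<close>: a finite-dimensional affine subspace is a translate of the span of a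
  finite set.\<close>

definition finite_dim_affine_subspace :: "'a normed_space \<Rightarrow> 'a set \<Rightarrow> bool" where
  "finite_dim_affine_subspace E A \<longleftrightarrow>
     (\<exists>p\<in>carrier E. \<exists>B. finite B \<and> B \<subseteq> carrier E \<and> A = p <+\<^bsub>E\<^esub> lin_span E B)"

definition infinite_dimensional :: "'a normed_space \<Rightarrow> 'a set \<Rightarrow> bool" where
  "infinite_dimensional E S \<longleftrightarrow> S \<subseteq> carrier E \<and> \<not> (\<exists>A. finite_dim_affine_subspace E A \<and> S \<subseteq> A)"

end

(* In the Hilbert space of square-summable sequences take M_k x = x_k e_k, the gradient of the
   convex function x_k^2 / 2. An everywhere defined monotone operator that is continuous along
   lines is maximal monotone. Its zeros are the sequences with vanishing k-th coordinate, so finitely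
   many of the M_k leave infinitely many coordinates free, while all of them together leave only
   the zero sequence. *)

theory Submission
  imports Defs "HOL-Library.Function_Algebras"
begin

section \<open>Square-summable sequences\<close>

definition ell2 :: "(nat \<Rightarrow> real) set" where
  "ell2 = {x. summable (\<lambda>i. (x i)\<^sup>2)}"

definition ell2_norm :: "(nat \<Rightarrow> real) \<Rightarrow> real" where
  "ell2_norm x = sqrt (\<Sum>i. (x i)\<^sup>2)"

definition scale_seq :: "real \<Rightarrow> (nat \<Rightarrow> real) \<Rightarrow> nat \<Rightarrow> real" where
  "scale_seq a x = (\<lambda>i. a * x i)"

lemma scale_seq_apply [simp]: "scale_seq a x i = a * x i"
  by (simp add: scale_seq_def)

text \<open>The vector space structure is put on all real sequences, so that \<open>span\<close> and
  \<open>independent\<close> are available for the dimension count.\<close>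

interpretation seq: vector_space scale_seq
  by unfold_locales (auto simp: fun_eq_iff algebra_simps)

lemma ell2_norm_nonneg: "x \<in> ell2 \<Longrightarrow> 0 \<le> ell2_norm x"
  by (simp add: ell2_norm_def ell2_def suminf_nonneg)

lemma ell2_norm_power2: "x \<in> ell2 \<Longrightarrow> (ell2_norm x)\<^sup>2 = (\<Sum>i. (x i)\<^sup>2)"
  by (simp add: ell2_norm_def ell2_def suminf_nonneg)

lemma L2_set_le_ell2_norm:
  assumes "x \<in> ell2"
  shows "L2_set x {..<n} \<le> ell2_norm x"
  using assms by (auto simp: L2_set_def ell2_norm_def ell2_def intro!: sum_le_suminf)

lemma abs_le_ell2_norm:
  assumes "x \<in> ell2"
  shows "\<bar>x i\<bar> \<le> ell2_norm x"
proof -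
  have "\<bar>x i\<bar> \<le> L2_set x {..<Suc i}"
    \<comment> \<open>The rule bounds the entry itself, so it is applied to absolute values, which
      have the same squares.\<close>
    using member_le_L2_set[of "{..<Suc i}" i "\<lambda>i. \<bar>x i\<bar>"] by (simp add: L2_set_def)
  then show ?thesis
    using L2_set_le_ell2_norm[OF assms, of "Suc i"] by linarith
qed

text \<open>A uniform bound on finite sections bounds the increasing partial sums of squares.
  Together with \<open>L2_set_le_ell2_norm\<close> this carries finite-dimensional inequalities over
  to \<open>ell2\<close>.\<close>

lemma ell2_bound:
  assumes "\<And>n. L2_set x {..<n} \<le> C"
  shows "x \<in> ell2" "ell2_norm x \<le> C"
proof -
  have "0 \<le> C"
    using assms[of 0] by simp
  then have bd: "(\<Sum>i<n. (x i)\<^sup>2) \<le> C\<^sup>2" for n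
    using assms[of n] by (simp add: L2_set_def real_sqrt_le_iff' sum_nonneg)
  then show "x \<in> ell2"
    unfolding ell2_def using summableI_nonneg_bounded[of "\<lambda>i. (x i)\<^sup>2"] by auto
  then have "(ell2_norm x)\<^sup>2 \<le> C\<^sup>2"
    using bd by (auto simp: ell2_norm_power2 ell2_def intro: suminf_le_const)
  with \<open>0 \<le> C\<close> show "ell2_norm x \<le> C"
    by (rule power2_le_imp_le[rotated])
qed

text \<open>Minkowski's inequality on finite sections, carried over by
  \<open>ell2_bound\<close>.\<close>

lemma ell2_add:
  assumes "x \<in> ell2" "y \<in> ell2"
  shows "x + y \<in> ell2" "ell2_norm (x + y) \<le> ell2_norm x + ell2_norm y"
proof -
  have "L2_set (x + y) {..<n} \<le> ell2_norm x + ell2_norm y" for n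
    using L2_set_triangle_ineq[of x y "{..<n}"] L2_set_le_ell2_norm[OF assms(1), of n]
      L2_set_le_ell2_norm[OF assms(2), of n] by (simp add: plus_fun_def)
  then show "x + y \<in> ell2" "ell2_norm (x + y) \<le> ell2_norm x + ell2_norm y"
    by (rule ell2_bound)+
qed

lemma ell2_scale:
  assumes "x \<in> ell2"
  shows "scale_seq a x \<in> ell2" "ell2_norm (scale_seq a x) = \<bar>a\<bar> * ell2_norm x"
  using assms
  by (auto simp: ell2_def ell2_norm_def power_mult_distrib suminf_mult real_sqrt_mult
      intro: summable_mult)

lemma ell2_zero: "0 \<in> ell2"
  by (simp add: ell2_def)

lemma scale_seq_minus_one: "scale_seq (-1) x = - x"
  by (simp add: fun_eq_iff)

lemma ell2_uminus: "x \<in> ell2 \<Longrightarrow> - x \<in> ell2"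
  using ell2_scale(1)[of x "-1"] by (simp add: scale_seq_minus_one)

lemma ell2_diff: "x \<in> ell2 \<Longrightarrow> y \<in> ell2 \<Longrightarrow> x - y \<in> ell2"
  using ell2_add(1)[OF _ ell2_uminus] by fastforce

lemma ell2_norm_eq_zero_iff:
  assumes "x \<in> ell2"
  shows "ell2_norm x = 0 \<longleftrightarrow> x = 0"
  using assms by (auto simp: ell2_norm_def ell2_def suminf_eq_zero_iff fun_eq_iff)

text \<open>The scalar identity holds in each coordinate and is summed. Uniform convexity and
  uniform smoothness both rest on this law.\<close>

lemma ell2_parallelogram:
  assumes "x \<in> ell2" "y \<in> ell2"
  shows "(ell2_norm (x + y))\<^sup>2 + (ell2_norm (x - y))\<^sup>2 = 2 * (ell2_norm x)\<^sup>2 + 2 * (ell2_norm y)\<^sup>2"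
proof -
  note summ = assms ell2_add(1)[OF assms] ell2_diff[OF assms]
  have "(\<Sum>i. ((x + y) i)\<^sup>2) + (\<Sum>i. ((x - y) i)\<^sup>2) = (\<Sum>i. ((x + y) i)\<^sup>2 + ((x - y) i)\<^sup>2)"
    using summ by (intro suminf_add) (auto simp: ell2_def)
  also have "\<dots> = (\<Sum>i. 2 * (x i)\<^sup>2 + 2 * (y i)\<^sup>2)"
    by (intro arg_cong[of _ _ suminf]) (auto simp: power2_eq_square algebra_simps)
  also have "\<dots> = (\<Sum>i. 2 * (x i)\<^sup>2) + (\<Sum>i. 2 * (y i)\<^sup>2)"
    using summ by (intro suminf_add[symmetric] summable_mult) (auto simp: ell2_def)
  also have "\<dots> = 2 * (\<Sum>i. (x i)\<^sup>2) + 2 * (\<Sum>i. (y i)\<^sup>2)"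
    using summ by (simp add: suminf_mult ell2_def)
  finally show ?thesis
    using summ by (simp add: ell2_norm_power2 del: plus_fun_apply minus_apply)
qed

text \<open>Each coordinate is Cauchy, being bounded by the norm. The coordinatewise limit is also
  the limit in norm, because the Cauchy estimate on finite sections survives the passage to the
  limit.\<close>

lemma ell2_Cauchy_converges:
  fixes \<sigma> :: "nat \<Rightarrow> nat \<Rightarrow> real"
  assumes mem: "\<And>n. \<sigma> n \<in> ell2"
    and Cauchy: "\<And>\<epsilon>. 0 < \<epsilon> \<Longrightarrow> \<exists>N. \<forall>m\<ge>N. \<forall>n\<ge>N. ell2_norm (\<sigma> m - \<sigma> n) < \<epsilon>"
  shows "\<exists>x\<in>ell2. \<forall>\<epsilon>>0. \<exists>N. \<forall>n\<ge>N. ell2_norm (\<sigma> n - x) < \<epsilon>"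
proof -
  have "convergent (\<lambda>n. \<sigma> n i)" for i
  proof (rule Cauchy_convergent, rule metric_CauchyI)
    fix \<epsilon> :: real
    assume "0 < \<epsilon>"
    then obtain N where N: "\<forall>m\<ge>N. \<forall>n\<ge>N. ell2_norm (\<sigma> m - \<sigma> n) < \<epsilon>"
      using Cauchy by blast
    have "dist (\<sigma> m i) (\<sigma> n i) < \<epsilon>" if "m \<ge> N" "n \<ge> N" for m n
      using N that abs_le_ell2_norm[OF ell2_diff[OF mem[of m] mem[of n]], of i]
      by (fastforce simp: dist_real_def)
    then show "\<exists>N. \<forall>m\<ge>N. \<forall>n\<ge>N. dist (\<sigma> m i) (\<sigma> n i) < \<epsilon>"
      by blast
  qed
  then obtain x where x: "\<And>i. (\<lambda>n. \<sigma> n i) \<longlonglongrightarrow> x i"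
    unfolding convergent_def by metis
  have tail: "\<exists>N. \<forall>n\<ge>N. \<sigma> n - x \<in> ell2 \<and> ell2_norm (\<sigma> n - x) \<le> \<epsilon>" if "0 < \<epsilon>" for \<epsilon>
  proof -
    obtain N where N: "\<forall>m\<ge>N. \<forall>n\<ge>N. ell2_norm (\<sigma> m - \<sigma> n) < \<epsilon>"
      using Cauchy \<open>0 < \<epsilon>\<close> by blast
    \<comment> \<open>Let \<open>m\<close> tend to infinity with \<open>n\<close> and
      \<open>k\<close> fixed: only finitely many coordinates enter, and the bound does not depend on
      \<open>k\<close>.\<close>
    have "L2_set (\<sigma> n - x) {..<k} \<le> \<epsilon>" if "n \<ge> N" for n k
    proof (rule tendsto_upperbound)
      show "(\<lambda>m. L2_set (\<sigma> n - \<sigma> m) {..<k}) \<longlonglongrightarrow> L2_set (\<sigma> n - x) {..<k}"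
        unfolding L2_set_def by (auto intro!: tendsto_intros x)
      have "L2_set (\<sigma> n - \<sigma> m) {..<k} \<le> \<epsilon>" if "m \<ge> N" for m
        using L2_set_le_ell2_norm[OF ell2_diff[OF mem[of n] mem[of m]], of k] N that \<open>n \<ge> N\<close>
        by force
      then show "\<forall>\<^sub>F m in sequentially. L2_set (\<sigma> n - \<sigma> m) {..<k} \<le> \<epsilon>"
        by (auto simp: eventually_sequentially)
    qed simp
    then show ?thesis
      using ell2_bound by blast
  qed
  obtain N where "\<sigma> N - x \<in> ell2"
    using tail[of 1] by auto
  then have "x \<in> ell2"
    using ell2_diff[OF mem[of N], of "\<sigma> N - x"] by simp
  moreover have "\<exists>N. \<forall>n\<ge>N. ell2_norm (\<sigma> n - x) < \<epsilon>" if "0 < \<epsilon>" for \<epsilon>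
    \<comment> \<open>Halving turns the weak inequality of \<open>tail\<close> into a strict
      one.\<close>
    using tail[of "\<epsilon> / 2"] that by force
  ultimately show ?thesis
    by blast
qed

section \<open>The Hilbert space as a normed module\<close>

definition ell2_space :: "(nat \<Rightarrow> real) normed_space" where
  "ell2_space = \<lparr>carrier = ell2, mult = (\<lambda>_ _. 0), one = 0, zero = 0, add = (+),
     smult = scale_seq, nrm = ell2_norm\<rparr>"

lemma ell2_space_simps [simp]:
  "carrier ell2_space = ell2" "\<zero>\<^bsub>ell2_space\<^esub> = 0" "x \<oplus>\<^bsub>ell2_space\<^esub> y = x + y"
  "a \<odot>\<^bsub>ell2_space\<^esub> x = scale_seq a x" "\<parallel>x\<parallel>\<^bsub>ell2_space\<^esub> = ell2_norm x"
  by (simp_all add: ell2_space_def)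

interpretation ell2: real_normed_space ell2_space
proof (intro real_normed_space.intro real_normed_space_axioms.intro)
  have "abelian_group ell2_space"
    by (rule abelian_groupI) (auto simp: ell2_add ell2_zero intro: bexI[OF _ ell2_uminus])
  then show "Module.module (ring_of_type_algebra :: real ring) ell2_space"
    by (intro moduleI)
      (auto simp: ring_of_type_algebra_def ell2_scale fun_eq_iff algebra_simps
        intro: cring_from_type_algebra[unfolded ring_of_type_algebra_def])
qed (auto simp: ell2_norm_nonneg ell2_norm_eq_zero_iff ell2_scale ell2_add)

text \<open>Module subtraction goes through the abstract additive inverse, which uniqueness
  identifies with pointwise negation on the carrier.\<close>

lemma ell2_space_minus [simp]:
  assumes "x \<in> ell2" "y \<in> ell2"
  shows "x \<ominus>\<^bsub>ell2_space\<^esub> y = x - y"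
proof -
  have "\<ominus>\<^bsub>ell2_space\<^esub> y = - y"
    using assms by (intro ell2.M.minus_equality) (auto simp: ell2_uminus)
  then show ?thesis
    by (simp add: a_minus_def)
qed

lemma real_banach_space_ell2: "real_banach_space ell2_space"
proof (intro real_banach_space.intro real_banach_space_axioms.intro ell2.real_normed_space_axioms)
  interpret Metric_space ell2 "ndist ell2_space"
    using ell2.Metric_space_ndist by simp
  have "mcomplete"
    unfolding mcomplete_def
  proof (intro allI impI)
    fix \<sigma>
    assume \<sigma>: "MCauchy \<sigma>"
    then have mem: "\<sigma> n \<in> ell2" for n
      by (auto simp: MCauchy_def)
    then have "\<exists>N. \<forall>m\<ge>N. \<forall>n\<ge>N. ell2_norm (\<sigma> m - \<sigma> n) < \<epsilon>" if "0 < \<epsilon>" for \<epsilon>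
      using \<sigma> that by (simp add: MCauchy_def ndist_def)
    with mem obtain x where "x \<in> ell2" "\<forall>\<epsilon>>0. \<exists>N. \<forall>n\<ge>N. ell2_norm (\<sigma> n - x) < \<epsilon>"
      using ell2_Cauchy_converges by blast
    then have "limitin mtopology \<sigma> x sequentially"
      using mem by (simp add: limit_metric_sequentially ndist_def)
    then show "\<exists>x. limitin mtopology \<sigma> x sequentially"
      by blast
  qed
  then show "Metric_space.mcomplete (carrier ell2_space) (ndist ell2_space)"
    by simp
qed

section \<open>Uniform convexity and uniform smoothness\<close>

text \<open>For unit vectors the parallelogram law bounds the squared norm of the midpoint by 1 -
  \<epsilon>^2/4, which is at most (1 - \<epsilon>^2/8)^2. Hence \<delta> = \<epsilon>^2/8.\<close>

lemma uniformly_convex_ell2: "uniformly_convex ell2_space"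
  unfolding uniformly_convex_def
proof (intro allI impI)
  fix \<epsilon> :: real
  assume \<epsilon>: "0 < \<epsilon> \<and> \<epsilon> \<le> 2"
  have "ell2_norm (scale_seq (1/2) (x + y)) \<le> 1 - \<epsilon>\<^sup>2 / 8"
    if xy: "x \<in> ell2" "y \<in> ell2" "ell2_norm x = 1" "ell2_norm y = 1" "\<epsilon> \<le> ell2_norm (x - y)" for x y
  proof (rule power2_le_imp_le)
    have "\<epsilon>\<^sup>2 \<le> (ell2_norm (x - y))\<^sup>2"
      using \<epsilon> xy by (intro power_mono) auto
    then have "(ell2_norm (x + y))\<^sup>2 / 4 \<le> 1 - \<epsilon>\<^sup>2 / 4"
      using ell2_parallelogram[OF xy(1,2)] xy by simp
    also have "\<dots> \<le> (1 - \<epsilon>\<^sup>2 / 8)\<^sup>2"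
      by (simp add: power2_diff)
    finally show "(ell2_norm (scale_seq (1/2) (x + y)))\<^sup>2 \<le> (1 - \<epsilon>\<^sup>2 / 8)\<^sup>2"
      using xy by (simp add: ell2_scale ell2_add power_divide)
    \<comment> \<open>Here \<epsilon> \<le> 2 enters: the bound must be nonnegative for the squares
      to be removed.\<close>
    have "\<epsilon>\<^sup>2 \<le> 2\<^sup>2"
      using \<epsilon> by (intro power_mono) auto
    then show "0 \<le> 1 - \<epsilon>\<^sup>2 / 8"
      by simp
  qed
  then show "\<exists>\<delta>>0. \<forall>x\<in>carrier ell2_space. \<forall>y\<in>carrier ell2_space.
      \<parallel>x\<parallel>\<^bsub>ell2_space\<^esub> = 1 \<and> \<parallel>y\<parallel>\<^bsub>ell2_space\<^esub> = 1 \<and> \<epsilon> \<le> \<parallel>x \<ominus>\<^bsub>ell2_space\<^esub> y\<parallel>\<^bsub>ell2_space\<^esub> \<longrightarrow>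
      \<parallel>(1/2) \<odot>\<^bsub>ell2_space\<^esub> (x \<oplus>\<^bsub>ell2_space\<^esub> y)\<parallel>\<^bsub>ell2_space\<^esub> \<le> 1 - \<delta>"
    using \<epsilon> by (intro exI[of _ "\<epsilon>\<^sup>2 / 8"]) auto
qed

text \<open>By the parallelogram law the mean of the two norms has square at most 1 + t^2, where t
  is the norm of \<open>y\<close>. The mean therefore exceeds 1 by at most t^2, which is at most
  \<epsilon> t once t \<le> \<epsilon>. Hence \<delta> = \<epsilon>.\<close>

lemma uniformly_smooth_ell2: "uniformly_smooth ell2_space"
  unfolding uniformly_smooth_def
proof (intro allI impI)
  fix \<epsilon> :: real
  assume \<epsilon>: "0 < \<epsilon>"
  have "(ell2_norm (x + y) + ell2_norm (x - y)) / 2 - 1 \<le> \<epsilon> * ell2_norm y"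
    if xy: "x \<in> ell2" "y \<in> ell2" "ell2_norm x = 1" "ell2_norm y \<le> \<epsilon>" for x y
  proof -
    let ?a = "ell2_norm (x + y)" and ?b = "ell2_norm (x - y)" and ?t = "ell2_norm y"
    have "((?a + ?b) / 2)\<^sup>2 \<le> 1 + ?t\<^sup>2"
      using ell2_parallelogram[OF xy(1,2)] xy(3) sum_squares_bound[of ?a ?b]
      by (simp add: power_divide power2_sum)
    \<comment> \<open>This weakening replaces the square root of 1 + t^2 by 1 + t^2 itself.\<close>
    also have "\<dots> \<le> (1 + ?t\<^sup>2)\<^sup>2"
      by (simp add: power2_sum)
    finally have "(?a + ?b) / 2 \<le> 1 + ?t\<^sup>2"
      by (rule power2_le_imp_le) simp
    moreover have "?t\<^sup>2 \<le> \<epsilon> * ?t"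
      using xy(4) ell2_norm_nonneg[OF xy(2)] by (simp add: power2_eq_square mult_right_mono)
    ultimately show ?thesis
      by linarith
  qed
  then show "\<exists>\<delta>>0. \<forall>x\<in>carrier ell2_space. \<forall>y\<in>carrier ell2_space.
      \<parallel>x\<parallel>\<^bsub>ell2_space\<^esub> = 1 \<and> \<parallel>y\<parallel>\<^bsub>ell2_space\<^esub> \<le> \<delta> \<longrightarrow>
      (\<parallel>x \<oplus>\<^bsub>ell2_space\<^esub> y\<parallel>\<^bsub>ell2_space\<^esub> + \<parallel>x \<ominus>\<^bsub>ell2_space\<^esub> y\<parallel>\<^bsub>ell2_space\<^esub>) / 2 - 1 \<le> \<epsilon> * \<parallel>y\<parallel>\<^bsub>ell2_space\<^esub>"
    using \<epsilon> by (intro exI[of _ \<epsilon>]) auto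
qed

section \<open>Infinite-dimensional subsets\<close>

text \<open>Passes from module sums to the span in \<open>seq\<close>, where independent sets can be
  counted.\<close>

lemma lin_span_ell2_subset:
  assumes "finite B" "B \<subseteq> ell2"
  shows "lin_span ell2_space B \<subseteq> seq.span B"
proof -
  \<comment> \<open>The induction runs over subsets of \<open>B\<close> while the span stays that of
    the whole of \<open>B\<close>.\<close>
  have "(\<Oplus>\<^bsub>ell2_space\<^esub>v\<in>C. c v \<odot>\<^bsub>ell2_space\<^esub> v) \<in> seq.span B" if "C \<subseteq> B" for c C
    using finite_subset[OF that assms(1)] that
  proof (induction C rule: finite_induct)
    case empty
    then show ?case
      by (simp only: ell2.M.finsum_empty ell2_space_simps seq.span_zero)
  next
    case (insert v C)
    have scaled: "c w \<odot>\<^bsub>ell2_space\<^esub> w \<in> carrier ell2_space" if "w \<in> B" for w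
      using that assms(2) by (auto intro: ell2_scale)
    have sum: "(\<Oplus>\<^bsub>ell2_space\<^esub>w\<in>insert v C. c w \<odot>\<^bsub>ell2_space\<^esub> w) =
        scale_seq (c v) v + (\<Oplus>\<^bsub>ell2_space\<^esub>w\<in>C. c w \<odot>\<^bsub>ell2_space\<^esub> w)"
      using insert.hyps insert.prems scaled by (subst ell2.M.finsum_insert) auto
    have "scale_seq (c v) v \<in> seq.span B"
      using insert.prems by (intro seq.span_scale seq.span_base) blast
    moreover have "(\<Oplus>\<^bsub>ell2_space\<^esub>w\<in>C. c w \<odot>\<^bsub>ell2_space\<^esub> w) \<in> seq.span B"
      using insert.prems by (intro insert.IH) blast
    ultimately show ?case
      unfolding sum by (rule seq.span_add)
  qed
  then show ?thesis
    by (auto simp: lin_span_def)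
qed

definition unit_seq :: "nat \<Rightarrow> nat \<Rightarrow> real" where
  "unit_seq n = (\<lambda>i. if i = n then 1 else 0)"

lemma unit_seq_in_ell2: "unit_seq n \<in> ell2"
  unfolding ell2_def unit_seq_def by (auto intro!: summable_finite[of "{n}"] split: if_splits)

lemma inj_unit_seq: "inj unit_seq"
  by (auto simp: inj_def unit_seq_def fun_eq_iff split: if_splits)

text \<open>Evaluating a vanishing combination at coordinate \<open>n\<close> isolates the
  coefficient of \<open>unit_seq n\<close>.\<close>

lemma independent_unit_seqs: "seq.independent (range unit_seq)"
  unfolding seq.independent_explicit_module
proof (intro allI impI)
  fix t u v
  assume t: "finite t" "t \<subseteq> range unit_seq" "(\<Sum>v\<in>t. scale_seq (u v) v) = 0" "v \<in> t"
  then obtain n where n: "v = unit_seq n"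
    by blast
  have "0 = (\<Sum>w\<in>t. scale_seq (u w) w) n"
    using t by simp
  also have "\<dots> = (\<Sum>w\<in>t. u w * w n)"
    by (induction t rule: infinite_finite_induct) auto
  also have "\<dots> = (\<Sum>w\<in>t. if w = v then u v else 0)"
  proof (rule sum.cong)
    fix w
    assume "w \<in> t"
    then obtain m where "w = unit_seq m"
      using t(2) by blast
    \<comment> \<open>Injectivity first reduces equality of sequences to equality of indices; only
      then is \<open>unit_seq\<close> unfolded.\<close>
    then show "u w * w n = (if w = v then u v else 0)"
      using n inj_unit_seq by (simp add: inj_eq) (simp add: unit_seq_def)
  qed simp
  also have "\<dots> = u v"
    using t by simp
  finally show "u v = 0"
    by simp
qed

text \<open>A finite-dimensional affine subspace lies in the span of a finite set, which cannot
  contain infinitely many independent vectors.\<close>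

lemma infinite_dimensional_ell2I:
  assumes "S \<subseteq> ell2" "infinite I" "unit_seq ` I \<subseteq> S"
  shows "infinite_dimensional ell2_space S"
  unfolding infinite_dimensional_def finite_dim_affine_subspace_def
proof (intro conjI notI; (elim exE conjE bexE)?)
  fix A p B
  assume *: "S \<subseteq> A" "p \<in> carrier ell2_space" "finite B" "B \<subseteq> carrier ell2_space"
    "A = p <+\<^bsub>ell2_space\<^esub> lin_span ell2_space B"
  \<comment> \<open>Adjoining the base point \<open>p\<close> to the generators absorbs the
    translation.\<close>
  have "A \<subseteq> seq.span (insert p B)"
    using * lin_span_ell2_subset[of B] seq.span_mono[of B "insert p B"]
    by (auto simp: a_l_coset_def' intro!: seq.span_add intro: seq.span_base)
  then have "unit_seq ` I \<subseteq> seq.span (insert p B)"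
    using assms(3) \<open>S \<subseteq> A\<close> by blast
  moreover have "seq.independent (unit_seq ` I)"
    using independent_unit_seqs by (rule seq.independent_mono) blast
  ultimately have "finite (unit_seq ` I)"
    using seq.independent_span_bound \<open>finite B\<close> by (metis finite_insert)
  then show False
    using assms(2) inj_unit_seq finite_imageD inj_on_subset by blast
qed (use assms in simp)

section \<open>Coordinate projections as monotone operators\<close>

text \<open>The restriction to \<open>ell2\<close> makes the functional extensional, as membership
  in \<open>dual\<close> demands.\<close>

definition coord_op :: "nat \<Rightarrow> (nat \<Rightarrow> real) \<Rightarrow> ((nat \<Rightarrow> real) \<Rightarrow> real) set" where
  "coord_op k x = {\<lambda>y\<in>ell2. x k * y k}"

lemma coord_op_in_dual:
  "x \<in> ell2 \<Longrightarrow> (\<lambda>y\<in>ell2. x k * y k) \<in> dual ell2_space"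
  by (auto simp: dual_def ell2_add ell2_scale algebra_simps abs_mult
      intro!: exI[of _ "\<bar>x k\<bar>"] mult_right_mono abs_le_ell2_norm)

text \<open>The pairing of the differences is the square of \<open>x k - y k\<close>.\<close>

lemma monotone_coord_op: "monotone_operator ell2_space (coord_op k)"
  using coord_op_in_dual
  by (auto simp: monotone_operator_def set_valued_operator_def coord_op_def ell2_diff
      simp flip: left_diff_distrib)

(* Minty's argument: test monotonicity at z against z - t w and let t decrease to 0. *)
lemma coord_op_monotone_extension:
  assumes M': "monotone_operator ell2_space M'"
    and sub: "op_graph ell2_space (coord_op k) \<subseteq> op_graph ell2_space M'"
    and z: "z \<in> ell2" and f: "f \<in> M' z"
  shows "f \<in> coord_op k z"
proof -
  have fd: "f \<in> dual ell2_space"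
    using M' z f by (auto simp: monotone_operator_def set_valued_operator_def)
  have f_scale: "f (scale_seq a w) = a * f w" if "w \<in> ell2" for a w
    using fd that by (simp add: dual_def)
  have ge: "z k * w k \<le> f w" if w: "w \<in> ell2" for w
  proof (rule tendsto_upperbound)
    show "((\<lambda>t. (z k - t * w k) * w k) \<longlongrightarrow> z k * w k) (at_right 0)"
      by (auto intro!: tendsto_eq_intros)
    have "(z k - t * w k) * w k \<le> f w" if t: "0 < t" for t
    proof -
      let ?y = "z - scale_seq t w"
      have y: "?y \<in> ell2"
        using z w by (simp add: ell2_diff ell2_scale)
      then have "(\<lambda>y\<in>ell2. ?y k * y k) \<in> M' ?y"
        using sub by (auto simp: op_graph_def coord_op_def)
      then have "0 \<le> f (z \<ominus>\<^bsub>ell2_space\<^esub> ?y) - (\<lambda>y\<in>ell2. ?y k * y k) (z \<ominus>\<^bsub>ell2_space\<^esub> ?y)"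
        using M' f z y unfolding monotone_operator_def by (metis ell2_space_simps(1))
      \<comment> \<open>Since \<open>z - ?y\<close> is \<open>scale_seq t w\<close>, homogeneity
        brings out the positive factor \<open>t\<close>, which then cancels.\<close>
      then have "0 \<le> t * (f w - (z k - t * w k) * w k)"
        using y z w f_scale[OF w, of t] by (simp add: ell2_scale algebra_simps)
      then show ?thesis
        using t by (simp add: zero_le_mult_iff)
    qed
    then show "\<forall>\<^sub>F t in at_right 0. (z k - t * w k) * w k \<le> f w"
      by (auto simp: eventually_at_filter)
  qed simp
  have "f w = z k * w k" if w: "w \<in> ell2" for w
    \<comment> \<open>The bound at \<open>w\<close> and at its negative gives both
      inequalities.\<close>
    using ge[OF w] ge[OF ell2_scale(1)[OF w, of "-1"]] f_scale[OF w, of "-1"] by simp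
  moreover have "f \<in> extensional ell2"
    using fd by (simp add: dual_def)
  ultimately show ?thesis
    by (auto simp: coord_op_def extensional_def fun_eq_iff)
qed

text \<open>Any pair in a monotone extension already belongs to the graph, so no extension is
  proper.\<close>

lemma maximal_monotone_coord_op: "maximal_monotone_operator ell2_space (coord_op k)"
  unfolding maximal_monotone_operator_def
proof (intro conjI monotone_coord_op notI; elim exE conjE)
  fix M'
  assume "monotone_operator ell2_space M'"
    and "op_graph ell2_space (coord_op k) \<subset> op_graph ell2_space M'"
  then show False
    using coord_op_monotone_extension[of M' k] by (fastforce simp: op_graph_def)
qed

lemma zeros_coord_op: "zeros ell2_space (coord_op k) = {x \<in> ell2. x k = 0}"
proof -
  have "x k = 0" if "(\<lambda>y\<in>ell2. 0) = (\<lambda>y\<in>ell2. x k * y k)" for x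
    \<comment> \<open>Evaluation at the \<open>k\<close>-th unit sequence recovers
      \<open>x k\<close>.\<close>
    using fun_cong[OF that, of "unit_seq k"] by (simp add: unit_seq_in_ell2) (simp add: unit_seq_def)
  then show ?thesis
    by (auto simp: zeros_def coord_op_def dual_zero_def)
qed

theorem proposition4p6:
  shows "\<exists>(E :: (nat \<Rightarrow> real) normed_space) (M :: nat \<Rightarrow> (nat \<Rightarrow> real) \<Rightarrow> ((nat \<Rightarrow> real) \<Rightarrow> real) set).
           real_banach_space E \<and> uniformly_smooth E \<and> uniformly_convex E \<and>
           (\<forall>k\<ge>1. maximal_monotone_operator E (M k)) \<and>
           is_singleton (\<Inter>k\<in>{1..}. zeros E (M k)) \<and>
           (\<forall>N\<ge>1. infinite_dimensional E (\<Inter>k\<in>{1..N}. zeros E (M k)))"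
proof (intro exI conjI allI impI)
  (* The family is indexed from 1 but sequences from 0. *)
  let ?M = "\<lambda>k. coord_op (k - 1)"
  show "is_singleton (\<Inter>k\<in>{1..}. zeros ell2_space (?M k))"
  proof (rule is_singletonI')
    show "(\<Inter>k\<in>{1..}. zeros ell2_space (?M k)) \<noteq> {}"
      using ell2_zero by (auto simp: zeros_coord_op intro!: exI[of _ 0])
    have "x i = 0" if "x \<in> (\<Inter>k\<in>{1..}. zeros ell2_space (?M k))" for x i
      \<comment> \<open>Coordinate \<open>i\<close> is controlled by the operator with index
        \<open>Suc i\<close>.\<close>
      using INT_D[OF that, of "Suc i"] by (simp add: zeros_coord_op)
    then show "x = y" if "x \<in> (\<Inter>k\<in>{1..}. zeros ell2_space (?M k))"
      "y \<in> (\<Inter>k\<in>{1..}. zeros ell2_space (?M k))" for x y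
      using that by (metis ext)
  qed
  show "infinite_dimensional ell2_space (\<Inter>k\<in>{1..N}. zeros ell2_space (?M k))" if "1 \<le> N" for N
  proof (rule infinite_dimensional_ell2I[of _ "{N..}"])
    \<comment> \<open>The first \<open>N\<close> operators constrain exactly the coordinates below
      \<open>N\<close>, so the unit sequences from \<open>N\<close> on are common zeros.\<close>
    show "unit_seq ` {N..} \<subseteq> (\<Inter>k\<in>{1..N}. zeros ell2_space (?M k))"
      by (auto simp: zeros_coord_op unit_seq_in_ell2) (auto simp: unit_seq_def)
    show "(\<Inter>k\<in>{1..N}. zeros ell2_space (?M k)) \<subseteq> ell2"
      \<comment> \<open>\<open>1 \<le> N\<close> makes the index set nonempty; an empty intersection
        would be the whole type.\<close>
      using that by (auto simp: zeros_coord_op)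
  qed (rule infinite_Ici)
qed (rule real_banach_space_ell2 uniformly_smooth_ell2 uniformly_convex_ell2 maximal_monotone_coord_op)+

end
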